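(* Let $n,m,N\ge 1$ be integers, $T>0$, $A\subseteq\mathbb{R}^m$ a compact set, $F:\mathbb{R}^n\times A\to\mathbb{R}^n$ a continuous map, and $h:\mathbb{R}^n\times A\to\mathbb{R}^N$, $g:\mathbb{R}^n\to\mathbb{R}^N$ given maps. Assume there is a constant $C$ such that for all $x,y\in\mathbb{R}^n$ and $a\in A$: $|F(x,a)|,|g(x)|,|h(x,a)|\le C$, $|F(x,a)-F(y,a)|\le C|x-y|$, $|g(x)-g(y)|\le C|x-y|$ and $|h(x,a)-h(y,a)|\le C|x-y|$. Let $K\subseteq\mathbb{R}^N$ be a proper cone with dual cone $K^*$, let $\lambda\in K^*$ and let $u^\lambda$ be a vectorial value function associated with $\lambda$ (see context). Then for any $(x,t)\in\mathbb{R}^n\times(0,T)$ and any $\delta>0$ such that $t+\delta\le T$, we have $$\lambda\cdot u^\lambda(x,t)=\inf_{\alpha\in\mathcal{A}}\bigg\{\lambda\cdot u^\lambda\big(\chi(t+\delta),t+\delta\big)+\int_t^{t+\delta}\lambda\cdot h(\chi(s),\alpha(s))\,ds\bigg\},$$ where $\chi$ is the solution of $\dot\chi(s)=F(\chi(s),\alpha(s))$, $t<s<T$, $\chi(t)=x$.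
   Context: A cone $K\subseteq\mathbb{R}^N$ is a non-empty set such that $\xi\in K$ implies $t\xi\in K$ for any $t\ge 0$. It is a proper cone if it is closed and convex, has non-empty interior, and $\xi\in K$ and $-\xi\in K$ imply $\xi=0$. It induces the partial ordering $\xi\le_K\eta \iff \eta-\xi\in K$. Its dual cone is $K^*=\{\eta\in\mathbb{R}^N : \eta\cdot\xi\ge 0 \text{ for all } \xi\in K\}$. The admissible controls are $\mathcal{A}=\{\alpha\in L^\infty(0,T) : \alpha(t)\in A \text{ for a.e. } t\in(0,T)\}$. For $(x,t)\in\mathbb{R}^n\times(0,T)$ and $\alpha\in\mathcal{A}$, with $\chi$ the solution of $\dot\chi(s)=F(\chi(s),\alpha(s))$ for $t<s<T$, $\chi(t)=x$, the vectorial cost functional is $$C_{x,t}[\alpha]=g(\chi(T))+\int_t^T h(\chi(s),\alpha(s))\,ds\in\mathbb{R}^N .$$ Set $S_{x,t}=\overline{\{C_{x,t}[\alpha] : \alpha\in\mathcal{A}\}}\subseteq\mathbb{R}^N$. A vectorial value function associated with $\lambda\in K^*$ is a map $u^\lambda:\mathbb{R}^n\times(0,T)\to\mathbb{R}^N$ such that, for every $(x,t)\in\mathbb{R}^n\times(0,T)$: (i) $u^\lambda(x,t)$ is a Pareto minimal of $S_{x,t}$, i.e. $u^\lambda(x,t)\in S_{x,t}$ and every $\eta\in S_{x,t}$ with $\eta\le_K u^\lambda(x,t)$ equals $u^\lambda(x,t)$; and (ii) $\lambda\cdot u^\lambda(x,t)=\inf_{\alpha\in\mathcal{A}}\{\lambda\cdot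 C_{x,t}[\alpha]\}$. When $t+\delta=T$, $\lambda\cdot u^\lambda(x,T)$ is understood as $\lambda\cdot g(x)$.
   Formalization: The running cost h(χ(s),α(s)) is additionally assumed integrable on (t,T) for every (x,t) and every admissible control α; for an h that is not measurable in a, the cost functional C_{x,t}[α] would be undefined. *)

theory Defs
  imports "HOL-Analysis.Analysis"
begin

definition proper_cone :: "'a::euclidean_space set \<Rightarrow> bool" where
  "proper_cone K \<longleftrightarrow> K \<noteq> {} \<and> cone K \<and> closed K \<and> convex K \<and> interior K \<noteq> {} \<and>
     (\<forall>\<xi>. \<xi> \<in> K \<and> - \<xi> \<in> K \<longrightarrow> \<xi> = 0)"

definition cone_le :: "'a::euclidean_space set \<Rightarrow> 'a \<Rightarrow> 'a \<Rightarrow> bool" where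
  "cone_le K \<xi> \<eta> \<longleftrightarrow> \<eta> - \<xi> \<in> K"

definition dual_cone :: "'a::euclidean_space set \<Rightarrow> 'a set" where
  "dual_cone K = {\<eta>. \<forall>\<xi>\<in>K. 0 \<le> \<eta> \<bullet> \<xi>}"

definition pareto_minimal :: "'a::euclidean_space set \<Rightarrow> 'a set \<Rightarrow> 'a \<Rightarrow> bool" where
  "pareto_minimal K S v \<longleftrightarrow> v \<in> S \<and> (\<forall>\<eta>\<in>S. cone_le K \<eta> v \<longrightarrow> \<eta> = v)"

text \<open>Controls are representatives of \<open>L\<^sup>\<infinity>\<close> classes: Lebesgue measurable, essentially bounded
  functions on \<open>(0,T)\<close>. Their values off \<open>(0,T)\<close> are irrelevant, and on a null set of times they
  may lie outside \<open>A\<close>. Dynamics \<open>F\<close> and running cost \<open>h\<close> are total functions, but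
  only their values at control arguments in \<open>A\<close> matter.\<close>

definition admissible_controls :: "real \<Rightarrow> 'm::euclidean_space set \<Rightarrow> (real \<Rightarrow> 'm) set" where
  "admissible_controls T A =
     {\<alpha>. \<alpha> \<in> borel_measurable (lebesgue_on {0<..<T}) \<and>
         (\<exists>M. AE s in lebesgue_on {0<..<T}. norm (\<alpha> s) \<le> M) \<and>
         (AE s in lebesgue_on {0<..<T}. \<alpha> s \<in> A)}"

text \<open>As controls are merely measurable, the Cauchy problem
  \<open>y'(s) = F(y(s), \<alpha>(s))\<close>, \<open>y(t) = x\<close> is understood in the sense of Caratheodory,
  that is, as an integral equation.\<close>

definition solves_state_eq ::
  "('n::euclidean_space \<Rightarrow> 'm::euclidean_space \<Rightarrow> 'n) \<Rightarrow> real \<Rightarrow> 'n \<Rightarrow> real \<Rightarrow> (real \<Rightarrow> 'm) \<Rightarrow>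
   (real \<Rightarrow> 'n) \<Rightarrow> bool" where
  "solves_state_eq F T x t \<alpha> y \<longleftrightarrow>
     continuous_on {t..T} y \<and>
     set_integrable lebesgue {t..T} (\<lambda>r. F (y r) (\<alpha> r)) \<and>
     (\<forall>s\<in>{t..T}. y s = x + (LINT r:{t..s}|lebesgue. F (y r) (\<alpha> r)))"

text \<open>A solution is determined only on \<open>[t,T]\<close>, hence \<open>SOME\<close> rather than \<open>THE\<close>; the values of
  the trajectory outside \<open>[t,T]\<close> are never used.\<close>

definition trajectory ::
  "('n::euclidean_space \<Rightarrow> 'm::euclidean_space \<Rightarrow> 'n) \<Rightarrow> real \<Rightarrow> 'n \<Rightarrow> real \<Rightarrow> (real \<Rightarrow> 'm) \<Rightarrow>
   real \<Rightarrow> 'n" where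
  "trajectory F T x t \<alpha> = (SOME y. solves_state_eq F T x t \<alpha> y)"

definition cost_functional ::
  "('n::euclidean_space \<Rightarrow> 'm::euclidean_space \<Rightarrow> 'n) \<Rightarrow> ('n \<Rightarrow> 'm \<Rightarrow> 'N::euclidean_space) \<Rightarrow>
   ('n \<Rightarrow> 'N) \<Rightarrow> real \<Rightarrow> 'n \<Rightarrow> real \<Rightarrow> (real \<Rightarrow> 'm) \<Rightarrow> 'N" where
  "cost_functional F h g T x t \<alpha> =
     g (trajectory F T x t \<alpha> T) +
     (LINT s:{t..T}|lebesgue. h (trajectory F T x t \<alpha> s) (\<alpha> s))"

definition cost_set ::
  "('n::euclidean_space \<Rightarrow> 'm::euclidean_space \<Rightarrow> 'n) \<Rightarrow> ('n \<Rightarrow> 'm \<Rightarrow> 'N::euclidean_space) \<Rightarrow>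
   ('n \<Rightarrow> 'N) \<Rightarrow> real \<Rightarrow> 'm set \<Rightarrow> 'n \<Rightarrow> real \<Rightarrow> 'N set" where
  "cost_set F h g T A x t = closure (cost_functional F h g T x t ` admissible_controls T A)"

text \<open>\<open>INF\<close> is the infimum in the reals. It is the genuine one when \<open>g\<close> and \<open>h\<close> are bounded:
  the costs are then bounded, and there is at least one control because \<open>u x t\<close>
  belongs to the closure of the set of costs.\<close>

definition vectorial_value_function ::
  "('n::euclidean_space \<Rightarrow> 'm::euclidean_space \<Rightarrow> 'n) \<Rightarrow> ('n \<Rightarrow> 'm \<Rightarrow> 'N::euclidean_space) \<Rightarrow>
   ('n \<Rightarrow> 'N) \<Rightarrow> real \<Rightarrow> 'm set \<Rightarrow> 'N set \<Rightarrow> 'N \<Rightarrow> ('n \<Rightarrow> real \<Rightarrow> 'N) \<Rightarrow> bool" where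
  "vectorial_value_function F h g T A K lam u \<longleftrightarrow>
     (\<forall>x. \<forall>t\<in>{0<..<T}.
        pareto_minimal K (cost_set F h g T A x t) (u x t) \<and>
        lam \<bullet> u x t = (INF \<alpha>\<in>admissible_controls T A. lam \<bullet> cost_functional F h g T x t \<alpha>))"

text \<open>A vectorial value function lives on times in \<open>(0,T)\<close>; at time \<open>T\<close> its scalarization
  is by convention that of the terminal cost.\<close>

definition scalarized_value ::
  "('n::euclidean_space \<Rightarrow> 'N::euclidean_space) \<Rightarrow> real \<Rightarrow> 'N \<Rightarrow> ('n \<Rightarrow> real \<Rightarrow> 'N) \<Rightarrow>
   'n \<Rightarrow> real \<Rightarrow> real" where
  "scalarized_value g T lam u x t = (if t = T then lam \<bullet> g x else lam \<bullet> u x t)"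

end

theory Submission
  imports Defs
begin

text \<open>
  The scalarization \<open>\<lambda> \<bullet> u\<close> is the value function of the scalar control problem with costs
  \<open>\<lambda> \<bullet> g\<close> and \<open>\<lambda> \<bullet> h\<close>, so the claim is Bellman's principle for that problem
  (\<open>dynamic_programming_principle\<close>). Since \<open>u x t\<close> lies in the closure of the set of costs, there
  are admissible controls; as the costs are also bounded, the infima are genuine. At \<open>\<tau> = T\<close> the
  claim is the definition of the cost, and the principle is needed for \<open>\<tau> < T\<close> only.

  The principle rests on two facts. First, the cost is additive along a trajectory: the cost
  started at \<open>(x, t)\<close> is the running cost on \<open>[t, \<tau>]\<close> plus the cost started at \<open>(\<chi>(\<tau>), \<tau>)\<close> with
  the same control (\<open>cost_functional_split\<close>). This gives \<open>\<ge>\<close>. Second, controls can be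
  concatenated: following any \<open>\<alpha>\<close> up to \<open>\<tau>\<close> and then any control \<open>\<beta>\<close>
  is admissible (\<open>concat_control_admissible\<close>), and its cost is the running cost of \<open>\<alpha>\<close> on \<open>[t, \<tau>]\<close> plus
  the cost of \<open>\<beta>\<close> started at \<open>(\<chi>(\<tau>), \<tau>)\<close> (\<open>cost_functional_concat\<close>). This gives \<open>\<le>\<close>.

  Both facts need the trajectory, chosen by \<open>SOME\<close>, to be a genuine solution that is determined on
  \<open>[t, T]\<close> by the initial datum and by the control up to null sets. Both existence and uniqueness
  come from one estimate (\<open>state_integral_contraction\<close>): for the norm
  \<open>sup\<^sub>s |y(s)| / exp (2 L (s - t))\<close>, where \<open>L\<close> exceeds the Lipschitz constant of \<open>F\<close>, the Picard
  operator is a contraction on the whole of \<open>[t, T]\<close>, with factor \<open>1/2\<close>.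
\<close>

section \<open>Lebesgue integrals over intervals\<close>

text \<open>
  Integrability over \<open>S\<close> stands in for measurability on the whole space, which the integrands of the
  control problem lack: nothing controls them outside the time interval.
\<close>
lemma set_integral_cong_AE_integrable:
  fixes f g :: "'a \<Rightarrow> 'b::{banach, second_countable_topology}"
  assumes "set_integrable M S f" "set_integrable M S g"
    and "AE r in M. r \<in> S \<longrightarrow> f r = g r"
  shows "(LINT r:S|M. f r) = (LINT r:S|M. g r)"
  unfolding set_lebesgue_integral_def
proof (rule integral_cong_AE)
  show "AE r in M. indicator S r *\<^sub>R f r = indicator S r *\<^sub>R g r"
    using assms(3) by eventually_elim (auto simp: indicator_def)
qed (use assms in \<open>auto simp: set_integrable_def\<close>)

lemma set_integral_inner_right:
  fixes f :: "'a \<Rightarrow> 'b::euclidean_space"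
  assumes "set_integrable M S f"
  shows "(LINT r:S|M. c \<bullet> f r) = c \<bullet> (LINT r:S|M. f r)"
proof -
  have "(LINT r:S|M. c \<bullet> f r) = (\<integral>r. c \<bullet> (indicator S r *\<^sub>R f r) \<partial>M)"
    by (simp add: set_lebesgue_integral_def)
  also have "\<dots> = c \<bullet> (LINT r:S|M. f r)"
    using assms unfolding set_lebesgue_integral_def set_integrable_def by (rule integral_inner_right)
  finally show ?thesis .
qed

lemma set_integrable_subinterval:
  fixes f :: "real \<Rightarrow> 'b::euclidean_space"
  assumes "set_integrable lebesgue {a..b} f" "a \<le> c" "d \<le> b"
  shows "set_integrable lebesgue {c..d} f"
  by (rule set_integrable_subset[OF assms(1)]) (use assms in auto)

lemma set_integral_combine_Icc:
  fixes f :: "real \<Rightarrow> 'b::euclidean_space"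
  assumes f: "set_integrable lebesgue {a..c} f" and "a \<le> b" "b \<le> c"
  shows "(LINT r:{a..c}|lebesgue. f r) =
    (LINT r:{a..b}|lebesgue. f r) + (LINT r:{b..c}|lebesgue. f r)"
proof -
  have "set_integrable lebesgue {a..b} f" "set_integrable lebesgue {b..c} f"
    using assms by (auto intro: set_integrable_subinterval[OF f])
  then show ?thesis
    using Henstock_Kurzweil_Integration.integral_combine[OF assms(2,3)
        set_lebesgue_integral_eq_integral(1)[OF f]] f
    by (simp add: set_lebesgue_integral_eq_integral(2))
qed

lemma continuous_on_indefinite_set_integral:
  fixes f :: "real \<Rightarrow> 'b::euclidean_space"
  assumes f: "set_integrable lebesgue {a..b} f"
  shows "continuous_on {a..b} (\<lambda>s. LINT r:{a..s}|lebesgue. f r)"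
proof (rule continuous_on_eq)
  show "continuous_on {a..b} (\<lambda>s. integral {a..s} f)"
    using f by (intro indefinite_integral_continuous_1 set_lebesgue_integral_eq_integral(1))
  show "integral {a..s} f = (LINT r:{a..s}|lebesgue. f r)" if "s \<in> {a..b}" for s
    using that set_integrable_subinterval[OF f, of a s]
    by (simp add: set_lebesgue_integral_eq_integral(2))
qed

lemma norm_set_integral_le_AE:
  fixes f :: "'a \<Rightarrow> 'b::euclidean_space"
  assumes f: "set_integrable M S f" and g: "set_integrable M S g"
    and le: "AE r in M. r \<in> S \<longrightarrow> norm (f r) \<le> g r"
  shows "norm (LINT r:S|M. f r) \<le> (LINT r:S|M. g r :: real)"
proof -
  have "norm (LINT r:S|M. f r) \<le> (\<integral>r. norm (indicator S r *\<^sub>R f r) \<partial>M)"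
    unfolding set_lebesgue_integral_def by (rule integral_norm_bound)
  also have "\<dots> \<le> (LINT r:S|M. g r)"
    unfolding set_lebesgue_integral_def
  proof (rule integral_mono_AE)
    show "AE r in M. norm (indicator S r *\<^sub>R f r) \<le> indicator S r *\<^sub>R g r"
      using le by eventually_elim (auto simp: indicator_def)
  qed (use f g integrable_norm in \<open>auto simp: set_integrable_def simp del: norm_scaleR\<close>)
  finally show ?thesis .
qed

text \<open>
  The rate \<open>2 L\<close> in the exponent, twice the prefactor \<open>L\<close>, is the source of the contraction factor
  \<open>1/2\<close> below.
\<close>
lemma exp_integral_le:
  fixes L M t s :: real
  assumes "L > 0" "M \<ge> 0" "t \<le> s"
  shows "set_integrable lebesgue {t..s} (\<lambda>r. L * (M * exp (2 * L * (r - t))))"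
    and "(LINT r:{t..s}|lebesgue. L * (M * exp (2 * L * (r - t)))) \<le> M / 2 * exp (2 * L * (s - t))"
proof -
  show int: "set_integrable lebesgue {t..s} (\<lambda>r. L * (M * exp (2 * L * (r - t))))"
    by (intro absolutely_integrable_continuous_real continuous_intros)
  have "((\<lambda>r. L * (M * exp (2 * L * (r - t)))) has_integral
      M / 2 * exp (2 * L * (s - t)) - M / 2 * exp (2 * L * (t - t))) {t..s}"
    using \<open>t \<le> s\<close>
    by (intro fundamental_theorem_of_calculus)
       (auto intro!: derivative_eq_intros simp: has_real_derivative_iff_has_vector_derivative[symmetric])
  then have "(LINT r:{t..s}|lebesgue. L * (M * exp (2 * L * (r - t)))) =
      M / 2 * exp (2 * L * (s - t)) - M / 2 * exp (2 * L * (t - t))"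
    unfolding set_lebesgue_integral_eq_integral(2)[OF int] by (rule integral_unique)
  then show "(LINT r:{t..s}|lebesgue. L * (M * exp (2 * L * (r - t)))) \<le>
      M / 2 * exp (2 * L * (s - t))"
    using \<open>M \<ge> 0\<close> by (simp only:) simp
qed

section \<open>Admissible controls\<close>

lemma admissible_AE_in:
  assumes "\<alpha> \<in> admissible_controls T A" "0 \<le> t" "s \<le> T"
  shows "AE r in lebesgue. r \<in> {t..s} \<longrightarrow> \<alpha> r \<in> A"
proof -
  have "AE r in lebesgue. r \<in> {0<..<T} \<longrightarrow> \<alpha> r \<in> A"
    using assms(1) by (simp add: admissible_controls_def AE_restrict_space_iff)
  moreover have "AE r in lebesgue. r \<noteq> (0::real)" "AE r in lebesgue. r \<noteq> T"
    by (auto intro!: AE_completion AE_lborel_singleton)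
  ultimately show ?thesis
    by eventually_elim (use assms in auto)
qed

lemma concat_control_admissible:
  fixes \<alpha> \<beta> :: "real \<Rightarrow> 'm::euclidean_space"
  assumes "\<alpha> \<in> admissible_controls T A" "\<beta> \<in> admissible_controls T A"
  shows "(\<lambda>s. if s < \<tau> then \<alpha> s else \<beta> s) \<in> admissible_controls T A"
proof -
  obtain M1 M2 where M: "AE s in lebesgue_on {0<..<T}. norm (\<alpha> s) \<le> M1"
      "AE s in lebesgue_on {0<..<T}. norm (\<beta> s) \<le> M2"
    using assms by (auto simp: admissible_controls_def)
  have meas: "(\<lambda>s. if s < \<tau> then \<alpha> s else \<beta> s) \<in> borel_measurable (lebesgue_on {0<..<T})"
  proof (rule measurable_If)
    have "{s \<in> space (lebesgue_on {0<..<T}). s < \<tau>} = {0<..<T} \<inter> {..<\<tau>}"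
      by auto
    also have "\<dots> \<in> sets (lebesgue_on {0<..<T})"
      by (auto simp: sets_restrict_space)
    finally show "{s \<in> space (lebesgue_on {0<..<T}). s < \<tau>} \<in> sets (lebesgue_on {0<..<T})" .
  qed (use assms in \<open>auto simp: admissible_controls_def\<close>)
  have "AE s in lebesgue_on {0<..<T}. norm (if s < \<tau> then \<alpha> s else \<beta> s) \<le> max M1 M2"
    using M by eventually_elim auto
  moreover have "AE s in lebesgue_on {0<..<T}. \<alpha> s \<in> A" "AE s in lebesgue_on {0<..<T}. \<beta> s \<in> A"
    using assms by (auto simp: admissible_controls_def)
  then have "AE s in lebesgue_on {0<..<T}. (if s < \<tau> then \<alpha> s else \<beta> s) \<in> A"
    by eventually_elim auto
  ultimately show ?thesis
    using meas unfolding admissible_controls_def by blast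
qed

section \<open>The state equation\<close>

text \<open>
  The integral equation has the unknown on both sides, so that as a rewrite rule it would loop; the
  definition is therefore used through a destruction and an introduction rule.
\<close>
lemma solves_state_eqD:
  assumes "solves_state_eq F S x t \<alpha> y"
  shows "continuous_on {t..S} y"
    and "set_integrable lebesgue {t..S} (\<lambda>r. F (y r) (\<alpha> r))"
    and "s \<in> {t..S} \<Longrightarrow> y s = x + (LINT r:{t..s}|lebesgue. F (y r) (\<alpha> r))"
  using assms unfolding solves_state_eq_def by blast+

lemma solves_state_eqI:
  assumes "continuous_on {t..S} y"
    and "set_integrable lebesgue {t..S} (\<lambda>r. F (y r) (\<alpha> r))"
    and "\<And>s. s \<in> {t..S} \<Longrightarrow> y s = x + (LINT r:{t..s}|lebesgue. F (y r) (\<alpha> r))"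
  shows "solves_state_eq F S x t \<alpha> y"
  using assms unfolding solves_state_eq_def by blast

locale lipschitz_dynamics =
  fixes T C :: real and A :: "'m::euclidean_space set"
    and F :: "'n::euclidean_space \<Rightarrow> 'm \<Rightarrow> 'n"
  assumes closed_A: "closed A"
    and continuous_F: "continuous_on (UNIV \<times> A) (\<lambda>(y, a). F y a)"
    and bounded_F: "\<And>y a. a \<in> A \<Longrightarrow> norm (F y a) \<le> C"
    and lipschitz_F: "\<And>y z a. a \<in> A \<Longrightarrow> norm (F y a - F z a) \<le> C * norm (y - z)"
begin

text \<open>
  Composition with \<open>F\<close> is measurable only where the control lies in \<open>A\<close>, because nothing is known
  about \<open>F\<close> elsewhere. Extending \<open>F\<close> by zero off the closed set \<open>UNIV \<times> A\<close> gives a Borel function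
  and changes the integrand on a null set only.
\<close>
lemma state_integrand_integrable:
  assumes \<alpha>: "\<alpha> \<in> admissible_controls T A" and "0 \<le> t" "s \<le> T"
    and y: "continuous_on {t..s} y"
  shows "set_integrable lebesgue {t..s} (\<lambda>r. F (y r) (\<alpha> r))"
proof -
  define G where "G p = indicat_real (UNIV \<times> A) p *\<^sub>R (case p of (y, a) \<Rightarrow> F y a)" for p
  define \<alpha>' where "\<alpha>' r = indicat_real {0<..<T} r *\<^sub>R \<alpha> r" for r
  define y' where "y' r = indicat_real {t..s} r *\<^sub>R y r" for r
  have [measurable]: "G \<in> borel_measurable borel"
    unfolding G_def
    by (intro borel_measurable_continuous_on_indicator continuous_F borel_closed
        closed_Times closed_UNIV closed_A)
  have \<alpha>'_meas: "\<alpha>' \<in> borel_measurable lebesgue"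
    using \<alpha> unfolding \<alpha>'_def admissible_controls_def
    by (subst borel_measurable_restrict_space_iff[symmetric]) auto
  have "y' \<in> borel_measurable borel"
    unfolding y'_def by (intro borel_measurable_continuous_on_indicator y) auto
  then have y'_meas: "y' \<in> borel_measurable lebesgue"
    by (intro measurable_completion) simp
  have G_meas: "(\<lambda>r. G (y' r, \<alpha>' r)) \<in> borel_measurable lebesgue"
    by (rule measurable_compose[OF borel_measurable_Pair[OF y'_meas \<alpha>'_meas]]) simp
  have "norm (G p) \<le> max 0 C" for p
    using bounded_F[of "snd p" "fst p"]
    by (cases p) (auto simp: G_def indicator_def le_max_iff_disj)
  then have G_int: "integrable lebesgue (\<lambda>r. indicator {t..s} r *\<^sub>R G (y' r, \<alpha>' r))"
    using G_meas
    by (intro integrableI_bounded_set_indicator[where B = "max 0 C"])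
       (auto simp: emeasure_lborel_Icc_eq)
  have "AE r in lebesgue. r \<noteq> (0::real)" "AE r in lebesgue. r \<noteq> T"
    by (auto intro!: AE_completion AE_lborel_singleton)
  then have "AE r in lebesgue. r \<in> {t..s} \<longrightarrow> F (y r) (\<alpha> r) = G (y' r, \<alpha>' r)"
    using admissible_AE_in[OF assms(1-3)]
    by eventually_elim (use assms(2,3) in \<open>auto simp: G_def y'_def \<alpha>'_def indicator_def\<close>)
  then obtain Z where Z: "negligible Z"
      "{r. \<not> (r \<in> {t..s} \<longrightarrow> F (y r) (\<alpha> r) = G (y' r, \<alpha>' r))} \<subseteq> Z"
    unfolding eventually_ae_filter_negligible by blast
  show ?thesis
  proof (rule absolutely_integrable_spike[OF _ Z(1)])
    show "set_integrable lebesgue {t..s} (\<lambda>r. G (y' r, \<alpha>' r))"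
      using G_int unfolding set_integrable_def .
    show "F (y r) (\<alpha> r) = G (y' r, \<alpha>' r)" if "r \<in> {t..s} - Z" for r
      using that Z(2) by blast
  qed
qed

text \<open>
  Any rate above the Lipschitz constant works; the exponential weight absorbs the length of the
  time interval, so that no subdivision of it is needed.
\<close>
definition rate :: real where "rate = \<bar>C\<bar> + 1"

lemma rate_pos: "rate > 0"
  by (simp add: rate_def)

text \<open>
  For \<open>y\<close> and \<open>z\<close> at weighted distance \<open>M\<close>, the Lipschitz bound leaves the integral of
  \<open>rate * M * exp (2 * rate * (r - t))\<close>, which is at most half as large as the weight at \<open>s\<close> times \<open>M\<close>.
  Existence and uniqueness of trajectories both rest on this.
\<close>
lemma state_integral_contraction:
  assumes \<alpha>: "\<alpha> \<in> admissible_controls T A" and ts: "0 \<le> t" "t \<le> s" "s \<le> T"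
    and y: "continuous_on {t..s} y" and z: "continuous_on {t..s} z"
    and close: "\<And>r. r \<in> {t..s} \<Longrightarrow> norm (y r - z r) \<le> M * exp (2 * rate * (r - t))"
  shows "norm ((LINT r:{t..s}|lebesgue. F (y r) (\<alpha> r)) - (LINT r:{t..s}|lebesgue. F (z r) (\<alpha> r)))
    \<le> M / 2 * exp (2 * rate * (s - t))"
proof -
  have int: "set_integrable lebesgue {t..s} (\<lambda>r. F (y r) (\<alpha> r))"
      "set_integrable lebesgue {t..s} (\<lambda>r. F (z r) (\<alpha> r))"
    using state_integrand_integrable \<alpha> ts y z by auto
  have "M \<ge> 0"
    using close[of t] ts order_trans[OF norm_ge_zero] by fastforce
  have "norm (LINT r:{t..s}|lebesgue. F (y r) (\<alpha> r) - F (z r) (\<alpha> r))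
      \<le> (LINT r:{t..s}|lebesgue. rate * (M * exp (2 * rate * (r - t))))"
  proof (rule norm_set_integral_le_AE)
    show "AE r in lebesgue. r \<in> {t..s} \<longrightarrow>
        norm (F (y r) (\<alpha> r) - F (z r) (\<alpha> r)) \<le> rate * (M * exp (2 * rate * (r - t)))"
      using admissible_AE_in[OF \<alpha> ts(1,3)]
    proof eventually_elim
      case (elim r)
      show ?case
      proof
        assume r: "r \<in> {t..s}"
        have "norm (F (y r) (\<alpha> r) - F (z r) (\<alpha> r)) \<le> C * norm (y r - z r)"
          using elim r by (intro lipschitz_F) auto
        also have "\<dots> \<le> rate * norm (y r - z r)"
          by (intro mult_right_mono) (auto simp: rate_def)
        also have "\<dots> \<le> rate * (M * exp (2 * rate * (r - t)))"
          using close[OF r] rate_pos by (intro mult_left_mono) auto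
        finally show "norm (F (y r) (\<alpha> r) - F (z r) (\<alpha> r)) \<le> \<dots>" .
      qed
    qed
  qed (use int exp_integral_le[OF rate_pos \<open>M \<ge> 0\<close> ts(2)] in auto)
  also have "\<dots> \<le> M / 2 * exp (2 * rate * (s - t))"
    by (rule exp_integral_le[OF rate_pos \<open>M \<ge> 0\<close> ts(2)])
  finally show ?thesis
    using int by simp
qed

text \<open>
  The unknown of the fixed point problem is the weighted function \<open>y(s) / exp (2 rate (s - t))\<close>,
  for which the contraction is one in the plain sup norm. Clamping times to \<open>[t, T]\<close> turns it into a
  bounded continuous function on the whole line, where Banach's theorem is at hand.
\<close>
lemma solution_exists:
  assumes \<alpha>: "\<alpha> \<in> admissible_controls T A" and "0 \<le> t" "t \<le> T"
  shows "\<exists>y. solves_state_eq F T x t \<alpha> y"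
proof -
  define clamp where "clamp s = max t (min T s)" for s
  define e where "e s = exp (2 * rate * (s - t))" for s
  define Y :: "(real \<Rightarrow>\<^sub>C 'n) \<Rightarrow> real \<Rightarrow> 'n" where "Y w r = e r *\<^sub>R w r" for w r
  define P where "P w s = x + (LINT r:{t..s}|lebesgue. F (Y w r) (\<alpha> r))" for w s
  define \<Phi> where "\<Phi> w = Bcontfun (\<lambda>s. inverse (e (clamp s)) *\<^sub>R P w (clamp s))" for w
  have e_pos: "e s > 0" for s
    by (simp add: e_def)
  have clamp: "clamp s \<in> {t..T}" for s
    using \<open>t \<le> T\<close> by (auto simp: clamp_def)
  have clamp_cont: "continuous_on UNIV clamp"
    unfolding clamp_def by (intro continuous_intros)
  have Y_cont: "continuous_on S (Y w)" for S w
    unfolding Y_def e_def by (intro continuous_intros continuous_on_apply_bcontfun)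
  have Y_int: "set_integrable lebesgue {t..T} (\<lambda>r. F (Y w r) (\<alpha> r))" for w
    using state_integrand_integrable[OF \<alpha> \<open>0 \<le> t\<close> order.refl Y_cont] .
  have P_cont: "continuous_on {t..T} (P w)" for w
    unfolding P_def
    by (intro continuous_intros continuous_on_indefinite_set_integral Y_int)
  have \<Phi>_apply: "\<Phi> w s = inverse (e (clamp s)) *\<^sub>R P w (clamp s)" for w s
  proof -
    let ?q = "\<lambda>s. inverse (e s) *\<^sub>R P w s"
    have q_cont: "continuous_on {t..T} ?q"
      unfolding e_def by (intro continuous_intros P_cont) simp
    have "continuous_on UNIV (\<lambda>s. ?q (clamp s))"
      using continuous_on_compose2[OF q_cont clamp_cont] clamp by blast
    moreover have "bounded (range (\<lambda>s. ?q (clamp s)))"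
      by (rule bounded_subset[OF compact_imp_bounded[OF
            compact_continuous_image[OF q_cont compact_Icc]]])
         (use clamp in auto)
    ultimately show ?thesis
      unfolding \<Phi>_def by (subst Bcontfun_inverse) (auto simp: bcontfun_def)
  qed
  have contraction: "dist (\<Phi> v) (\<Phi> w) \<le> 1 / 2 * dist v w" for v w
  proof (rule dist_bound)
    fix s
    have "norm (P v (clamp s) - P w (clamp s)) \<le> dist v w / 2 * e (clamp s)"
      unfolding P_def e_def add_diff_cancel_left
    proof (rule state_integral_contraction)
      show "norm (Y v r - Y w r) \<le> dist v w * exp (2 * rate * (r - t))" for r
        using dist_bounded[of v r w] e_pos[of r]
        by (simp add: Y_def scaleR_diff_right[symmetric] dist_norm e_def mult.commute)
    qed (use \<alpha> \<open>0 \<le> t\<close> clamp[of s] Y_cont in auto)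
    then have "inverse (e (clamp s)) * norm (P v (clamp s) - P w (clamp s)) \<le>
        inverse (e (clamp s)) * (dist v w / 2 * e (clamp s))"
      using e_pos[of "clamp s"] by (intro mult_left_mono) auto
    also have "\<dots> = 1 / 2 * dist v w"
      using e_pos[of "clamp s"] by simp
    also have "inverse (e (clamp s)) * norm (P v (clamp s) - P w (clamp s)) = dist (\<Phi> v s) (\<Phi> w s)"
      using e_pos[of "clamp s"]
      unfolding \<Phi>_apply dist_norm scaleR_diff_right[symmetric] by simp
    finally show "dist (\<Phi> v s) (\<Phi> w s) \<le> 1 / 2 * dist v w" .
  qed
  have "\<exists>!w. \<Phi> w = w"
    by (rule banach_fix_type[of "1/2"]) (simp, simp, intro allI contraction)
  then obtain w where w: "\<Phi> w = w"
    by blast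
  have fixed: "Y w s = P w s" if "s \<in> {t..T}" for s
  proof -
    have "clamp s = s"
      using that by (auto simp: clamp_def)
    then have "w s = inverse (e s) *\<^sub>R P w s"
      using \<Phi>_apply[of w s] unfolding w by metis
    then have "Y w s = e s *\<^sub>R (inverse (e s) *\<^sub>R P w s)"
      unfolding Y_def by (rule arg_cong)
    also have "\<dots> = P w s"
      using e_pos[of s] by simp
    finally show ?thesis .
  qed
  have "solves_state_eq F T x t \<alpha> (Y w)"
    using Y_cont[of "{t..T}" w] Y_int[of w] fixed unfolding P_def by (rule solves_state_eqI)
  then show ?thesis
    by (rule exI[where x = "Y w"])
qed

lemma trajectory_solves:
  assumes "\<alpha> \<in> admissible_controls T A" "0 \<le> t" "t \<le> T"
  shows "solves_state_eq F T x t \<alpha> (trajectory F T x t \<alpha>)"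
  unfolding trajectory_def using someI_ex[OF solution_exists[OF assms]] .

lemma solution_restrict:
  assumes y: "solves_state_eq F S x t \<alpha> y" and "\<tau> \<le> S"
  shows "solves_state_eq F \<tau> x t \<alpha> y"
proof (rule solves_state_eqI)
  show "continuous_on {t..\<tau>} y"
    by (rule continuous_on_subset[OF solves_state_eqD(1)[OF y]]) (use \<open>\<tau> \<le> S\<close> in auto)
  show "set_integrable lebesgue {t..\<tau>} (\<lambda>r. F (y r) (\<alpha> r))"
    by (rule set_integrable_subinterval[OF solves_state_eqD(2)[OF y]]) (use \<open>\<tau> \<le> S\<close> in auto)
  show "y s = x + (LINT r:{t..s}|lebesgue. F (y r) (\<alpha> r))" if "s \<in> {t..\<tau>}" for s
    by (rule solves_state_eqD(3)[OF y]) (use that \<open>\<tau> \<le> S\<close> in auto)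
qed

lemma solution_tail:
  assumes y: "solves_state_eq F S x t \<alpha> y" and "t \<le> \<tau>" "\<tau> \<le> S"
  shows "solves_state_eq F S (y \<tau>) \<tau> \<alpha> y"
proof (rule solves_state_eqI)
  note int = solves_state_eqD(2)[OF y]
  show "continuous_on {\<tau>..S} y"
    by (rule continuous_on_subset[OF solves_state_eqD(1)[OF y]]) (use \<open>t \<le> \<tau>\<close> in auto)
  show "set_integrable lebesgue {\<tau>..S} (\<lambda>r. F (y r) (\<alpha> r))"
    by (rule set_integrable_subinterval[OF int]) (use \<open>t \<le> \<tau>\<close> in auto)
  fix s assume s: "s \<in> {\<tau>..S}"
  have "y s = x + (LINT r:{t..s}|lebesgue. F (y r) (\<alpha> r))"
    by (rule solves_state_eqD(3)[OF y]) (use s \<open>t \<le> \<tau>\<close> in auto)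
  also have "(LINT r:{t..s}|lebesgue. F (y r) (\<alpha> r)) =
      (LINT r:{t..\<tau>}|lebesgue. F (y r) (\<alpha> r)) + (LINT r:{\<tau>..s}|lebesgue. F (y r) (\<alpha> r))"
    using s assms(2,3)
    by (intro set_integral_combine_Icc set_integrable_subinterval[OF int]) auto
  also have "x + \<dots> = (x + (LINT r:{t..\<tau>}|lebesgue. F (y r) (\<alpha> r))) +
      (LINT r:{\<tau>..s}|lebesgue. F (y r) (\<alpha> r))"
    by (rule add.assoc[symmetric])
  also have "x + (LINT r:{t..\<tau>}|lebesgue. F (y r) (\<alpha> r)) = y \<tau>"
    by (rule solves_state_eqD(3)[OF y, symmetric]) (use assms(2,3) in auto)
  finally show "y s = y \<tau> + (LINT r:{\<tau>..s}|lebesgue. F (y r) (\<alpha> r))" .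
qed

lemma solution_cong_control:
  assumes y: "solves_state_eq F S x t \<beta> y"
    and \<alpha>: "\<alpha> \<in> admissible_controls T A" and "0 \<le> t" "S \<le> T"
    and eq: "AE r in lebesgue. r \<in> {t..S} \<longrightarrow> \<alpha> r = \<beta> r"
  shows "solves_state_eq F S x t \<alpha> y"
proof (rule solves_state_eqI)
  note \<beta>_int = solves_state_eqD(2)[OF y]
  show "continuous_on {t..S} y"
    by (rule solves_state_eqD(1)[OF y])
  then show \<alpha>_int: "set_integrable lebesgue {t..S} (\<lambda>r. F (y r) (\<alpha> r))"
    by (rule state_integrand_integrable[OF \<alpha> \<open>0 \<le> t\<close> \<open>S \<le> T\<close>])
  fix s assume s: "s \<in> {t..S}"
  have "(LINT r:{t..s}|lebesgue. F (y r) (\<beta> r)) = (LINT r:{t..s}|lebesgue. F (y r) (\<alpha> r))"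
  proof (rule set_integral_cong_AE_integrable)
    show "AE r in lebesgue. r \<in> {t..s} \<longrightarrow> F (y r) (\<beta> r) = F (y r) (\<alpha> r)"
      using eq by eventually_elim (use s in auto)
  qed (use s in \<open>auto intro: set_integrable_subinterval[OF \<alpha>_int]
        set_integrable_subinterval[OF \<beta>_int]\<close>)
  then show "y s = x + (LINT r:{t..s}|lebesgue. F (y r) (\<alpha> r))"
    using solves_state_eqD(3)[OF y s] by metis
qed

text \<open>
  If \<open>M\<close> is the largest weighted distance between two solutions, the contraction estimate gives
  \<open>M \<le> M / 2\<close>.
\<close>
lemma solution_unique_same_control:
  assumes y: "solves_state_eq F S x t \<alpha> y" and z: "solves_state_eq F S x t \<alpha> z"
    and \<alpha>: "\<alpha> \<in> admissible_controls T A" and "0 \<le> t" "S \<le> T" and s: "s \<in> {t..S}"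
  shows "y s = z s"
proof -
  define e where "e s = exp (2 * rate * (s - t))" for s
  have e_pos: "e s > 0" for s
    by (simp add: e_def)
  have cont: "continuous_on {t..S} y" "continuous_on {t..S} z"
    using y z by (auto dest: solves_state_eqD(1))
  have "continuous_on {t..S} (\<lambda>s. norm (y s - z s) / e s)"
    unfolding e_def by (intro continuous_intros cont) simp
  then obtain m where m: "m \<in> {t..S}"
    and max: "\<And>s. s \<in> {t..S} \<Longrightarrow> norm (y s - z s) / e s \<le> norm (y m - z m) / e m"
    using continuous_attains_sup[of "{t..S}" "\<lambda>s. norm (y s - z s) / e s"] s by fastforce
  define M where "M = norm (y m - z m) / e m"
  have le_M: "norm (y r - z r) \<le> M * e r" if "r \<in> {t..S}" for r
    using max[OF that] e_pos[of r] by (simp add: M_def pos_divide_le_eq)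
  have "norm (y m - z m) \<le> M / 2 * e m"
  proof -
    have "y m - z m =
        (LINT r:{t..m}|lebesgue. F (y r) (\<alpha> r)) - (LINT r:{t..m}|lebesgue. F (z r) (\<alpha> r))"
      using solves_state_eqD(3)[OF y m] solves_state_eqD(3)[OF z m] by (metis add_diff_cancel_left)
    also have "norm \<dots> \<le> M / 2 * e m"
      unfolding e_def
      by (rule state_integral_contraction[OF \<alpha>])
         (use m assms le_M cont in \<open>auto simp: e_def intro: continuous_on_subset\<close>)
    finally show ?thesis .
  qed
  moreover have "norm (y m - z m) = M * e m"
    using e_pos[of m] by (simp add: M_def)
  ultimately have "M \<le> 0"
    using e_pos[of m] by (simp add: mult_le_0_iff)
  then have "norm (y s - z s) \<le> 0"
    using le_M[OF s] e_pos[of s] by (meson mult_nonpos_nonneg less_imp_le order_trans)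
  then show ?thesis
    by simp
qed

lemma solution_unique:
  assumes "solves_state_eq F S x t \<alpha> y" "solves_state_eq F S x t \<beta> z"
    and "\<alpha> \<in> admissible_controls T A" "0 \<le> t" "S \<le> T"
    and "AE r in lebesgue. r \<in> {t..S} \<longrightarrow> \<alpha> r = \<beta> r" "s \<in> {t..S}"
  shows "y s = z s"
  using solution_unique_same_control[OF assms(1) solution_cong_control[OF assms(2-6)] assms(3-5,7)] .

text \<open>Causality: a trajectory up to time \<open>S\<close> depends only on the control up to time \<open>S\<close>.\<close>
lemma trajectory_cong_control:
  assumes "\<alpha> \<in> admissible_controls T A" "\<beta> \<in> admissible_controls T A" "0 \<le> t" "S \<le> T"
    and "AE r in lebesgue. r \<in> {t..S} \<longrightarrow> \<alpha> r = \<beta> r" "s \<in> {t..S}"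
  shows "trajectory F T x t \<alpha> s = trajectory F T x t \<beta> s"
proof -
  have "t \<le> T"
    using assms(4,6) by simp
  have "solves_state_eq F S x t \<alpha> (trajectory F T x t \<alpha>)"
    by (rule solution_restrict[OF trajectory_solves[OF assms(1,3) \<open>t \<le> T\<close>] assms(4)])
  moreover have "solves_state_eq F S x t \<beta> (trajectory F T x t \<beta>)"
    by (rule solution_restrict[OF trajectory_solves[OF assms(2,3) \<open>t \<le> T\<close>] assms(4)])
  ultimately show ?thesis
    using assms(1,3-6) by (rule solution_unique)
qed

lemma trajectory_flow:
  assumes "\<alpha> \<in> admissible_controls T A" "0 \<le> t" "t \<le> \<tau>" "\<tau> \<le> T" "s \<in> {\<tau>..T}"
  shows "trajectory F T (trajectory F T x t \<alpha> \<tau>) \<tau> \<alpha> s = trajectory F T x t \<alpha> s"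
proof -
  have "0 \<le> \<tau>" "t \<le> T"
    using assms by auto
  show ?thesis
    by (rule solution_unique_same_control[OF trajectory_solves[OF assms(1) \<open>0 \<le> \<tau>\<close> assms(4)]
        solution_tail[OF trajectory_solves[OF assms(1,2) \<open>t \<le> T\<close>] assms(3,4)]
        assms(1) \<open>0 \<le> \<tau>\<close> order.refl assms(5)])
qed

end

section \<open>The cost and Bellman's principle\<close>

locale lipschitz_control_problem = lipschitz_dynamics T C A F
  for T C :: real and A :: "'m::euclidean_space set"
    and F :: "'n::euclidean_space \<Rightarrow> 'm \<Rightarrow> 'n" +
  fixes h :: "'n \<Rightarrow> 'm \<Rightarrow> 'N::euclidean_space" and g :: "'n \<Rightarrow> 'N"
  assumes bounded_h: "\<And>y a. a \<in> A \<Longrightarrow> norm (h y a) \<le> C"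
    and bounded_g: "\<And>y. norm (g y) \<le> C"
    and running_cost_integrable: "\<And>y s \<alpha>. s \<in> {0<..<T} \<Longrightarrow> \<alpha> \<in> admissible_controls T A \<Longrightarrow>
      set_integrable lebesgue {s..T} (\<lambda>r. h (trajectory F T y s \<alpha> r) (\<alpha> r))"
begin

lemma cost_functional_bounded:
  assumes \<alpha>: "\<alpha> \<in> admissible_controls T A" and t: "t \<in> {0<..<T}"
  shows "norm (cost_functional F h g T x t \<alpha>) \<le> C + C * (T - t)"
proof -
  have "norm (LINT s:{t..T}|lebesgue. h (trajectory F T x t \<alpha> s) (\<alpha> s)) \<le> (LINT s:{t..T}|lebesgue. C)"
  proof (rule norm_set_integral_le_AE)
    show "AE s in lebesgue. s \<in> {t..T} \<longrightarrow> norm (h (trajectory F T x t \<alpha> s) (\<alpha> s)) \<le> C"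
      using admissible_AE_in[OF \<alpha>, of t T] t by (auto elim!: eventually_mono intro: bounded_h)
  qed (use running_cost_integrable[OF t \<alpha>] in \<open>auto intro: absolutely_integrable_continuous_real\<close>)
  also have "\<dots> = C * (T - t)"
    using t by (simp add: set_lebesgue_integral_def)
  finally show ?thesis
    unfolding cost_functional_def by (intro norm_triangle_mono bounded_g)
qed

lemma scalarized_cost_bdd_below:
  assumes "t \<in> {0<..<T}"
  shows "bdd_below ((\<lambda>\<alpha>. l \<bullet> cost_functional F h g T x t \<alpha>) ` admissible_controls T A)"
proof (rule bdd_belowI2)
  fix \<alpha> assume \<alpha>: "\<alpha> \<in> admissible_controls T A"
  have "\<bar>l \<bullet> cost_functional F h g T x t \<alpha>\<bar> \<le> norm l * norm (cost_functional F h g T x t \<alpha>)"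
    by (rule Cauchy_Schwarz_ineq2)
  also have "\<dots> \<le> norm l * (C + C * (T - t))"
    by (intro mult_left_mono cost_functional_bounded[OF \<alpha> assms]) simp
  finally show "- (norm l * (C + C * (T - t))) \<le> l \<bullet> cost_functional F h g T x t \<alpha>"
    by linarith
qed

text \<open>By the flow property, the trajectory restarted at time \<open>\<tau>\<close> is the original one.\<close>
lemma cost_functional_split:
  assumes \<alpha>: "\<alpha> \<in> admissible_controls T A" and "0 < t" "t \<le> \<tau>" "\<tau> < T"
  shows "cost_functional F h g T x t \<alpha> =
    (LINT s:{t..\<tau>}|lebesgue. h (trajectory F T x t \<alpha> s) (\<alpha> s)) +
    cost_functional F h g T (trajectory F T x t \<alpha> \<tau>) \<tau> \<alpha>"
proof -
  have flow: "trajectory F T (trajectory F T x t \<alpha> \<tau>) \<tau> \<alpha> s = trajectory F T x t \<alpha> s"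
    if "s \<in> {\<tau>..T}" for s
    using trajectory_flow[OF \<alpha>, of t \<tau> s] that assms by simp
  have "(LINT s:{\<tau>..T}|lebesgue. h (trajectory F T (trajectory F T x t \<alpha> \<tau>) \<tau> \<alpha> s) (\<alpha> s)) =
      (LINT s:{\<tau>..T}|lebesgue. h (trajectory F T x t \<alpha> s) (\<alpha> s))"
    by (rule set_lebesgue_integral_cong) (auto simp: flow)
  moreover have "(LINT s:{t..T}|lebesgue. h (trajectory F T x t \<alpha> s) (\<alpha> s)) =
      (LINT s:{t..\<tau>}|lebesgue. h (trajectory F T x t \<alpha> s) (\<alpha> s)) +
      (LINT s:{\<tau>..T}|lebesgue. h (trajectory F T x t \<alpha> s) (\<alpha> s))"
    using assms by (intro set_integral_combine_Icc running_cost_integrable) auto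
  ultimately show ?thesis
    using flow[of T] assms by (simp add: cost_functional_def add.assoc add.left_commute)
qed

lemma running_cost_cong_control:
  assumes \<alpha>: "\<alpha> \<in> admissible_controls T A" and \<beta>: "\<beta> \<in> admissible_controls T A"
    and "0 < t" "t < T" "S \<le> T"
    and eq: "AE r in lebesgue. r \<in> {t..S} \<longrightarrow> \<alpha> r = \<beta> r"
  shows "(LINT s:{t..S}|lebesgue. h (trajectory F T x t \<alpha> s) (\<alpha> s)) =
    (LINT s:{t..S}|lebesgue. h (trajectory F T x t \<beta> s) (\<beta> s))"
proof (rule set_integral_cong_AE_integrable)
  have "trajectory F T x t \<alpha> r = trajectory F T x t \<beta> r" if "r \<in> {t..S}" for r
    using trajectory_cong_control[OF \<alpha> \<beta> _ _ eq] that assms by simp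
  then show "AE r in lebesgue. r \<in> {t..S} \<longrightarrow>
      h (trajectory F T x t \<alpha> r) (\<alpha> r) = h (trajectory F T x t \<beta> r) (\<beta> r)"
    using eq by (auto elim!: eventually_mono)
qed (use assms in \<open>auto intro!: set_integrable_subinterval[OF running_cost_integrable]\<close>)

lemma cost_functional_cong_control:
  assumes "\<alpha> \<in> admissible_controls T A" "\<beta> \<in> admissible_controls T A" "0 < t" "t < T"
    and "AE r in lebesgue. r \<in> {t..T} \<longrightarrow> \<alpha> r = \<beta> r"
  shows "cost_functional F h g T x t \<alpha> = cost_functional F h g T x t \<beta>"
  unfolding cost_functional_def
  using running_cost_cong_control[of \<alpha> \<beta> t T] trajectory_cong_control[of \<alpha> \<beta> t T T] assms
  by simp

lemma cost_functional_concat: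
  assumes \<alpha>: "\<alpha> \<in> admissible_controls T A" and \<beta>: "\<beta> \<in> admissible_controls T A"
    and t: "0 < t" "t \<le> \<tau>" "\<tau> < T"
  shows "cost_functional F h g T x t (\<lambda>s. if s < \<tau> then \<alpha> s else \<beta> s) =
    (LINT s:{t..\<tau>}|lebesgue. h (trajectory F T x t \<alpha> s) (\<alpha> s)) +
    cost_functional F h g T (trajectory F T x t \<alpha> \<tau>) \<tau> \<beta>"
proof -
  define \<gamma> where "\<gamma> = (\<lambda>s. if s < \<tau> then \<alpha> s else \<beta> s)"
  have \<gamma>: "\<gamma> \<in> admissible_controls T A"
    unfolding \<gamma>_def by (rule concat_control_admissible[OF \<alpha> \<beta>])
  \<comment> \<open>\<open>\<gamma>\<close> may differ from \<open>\<alpha>\<close> at the switching time itself, which is a null set\<close>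
  have "AE r in lebesgue. r \<noteq> \<tau>"
    by (auto intro!: AE_completion AE_lborel_singleton)
  then have before: "AE r in lebesgue. r \<in> {t..\<tau>} \<longrightarrow> \<gamma> r = \<alpha> r"
    by eventually_elim (auto simp: \<gamma>_def)
  have after: "AE r in lebesgue. r \<in> {\<tau>..T} \<longrightarrow> \<gamma> r = \<beta> r"
    by (auto simp: \<gamma>_def)
  have "trajectory F T x t \<gamma> \<tau> = trajectory F T x t \<alpha> \<tau>"
    using trajectory_cong_control[OF \<gamma> \<alpha> _ _ before] t by simp
  moreover have "(LINT s:{t..\<tau>}|lebesgue. h (trajectory F T x t \<gamma> s) (\<gamma> s)) =
      (LINT s:{t..\<tau>}|lebesgue. h (trajectory F T x t \<alpha> s) (\<alpha> s))"
    using running_cost_cong_control[OF \<gamma> \<alpha> _ _ _ before] t by simp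
  moreover have "cost_functional F h g T y \<tau> \<gamma> = cost_functional F h g T y \<tau> \<beta>" for y
    using cost_functional_cong_control[OF \<gamma> \<beta> _ _ after] t by simp
  ultimately show ?thesis
    using cost_functional_split[OF \<gamma> t] unfolding \<gamma>_def by simp
qed

text \<open>
  The cost of \<open>\<alpha>\<close> followed by \<open>\<beta>\<close> is an upper bound of the value for every \<open>\<beta>\<close>, so the infimum over \<open>\<beta>\<close>
  may be taken for each \<open>\<alpha>\<close> separately; no almost optimal \<open>\<beta>\<close> has to be selected depending on \<open>\<alpha>\<close>.
\<close>
theorem dynamic_programming_principle:
  assumes nonempty: "admissible_controls T A \<noteq> {}" and t: "0 < t" "t \<le> \<tau>" "\<tau> < T"
  shows "(INF \<alpha>\<in>admissible_controls T A. l \<bullet> cost_functional F h g T x t \<alpha>) =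
    (INF \<alpha>\<in>admissible_controls T A.
      (INF \<beta>\<in>admissible_controls T A.
        l \<bullet> cost_functional F h g T (trajectory F T x t \<alpha> \<tau>) \<tau> \<beta>) +
      l \<bullet> (LINT s:{t..\<tau>}|lebesgue. h (trajectory F T x t \<alpha> s) (\<alpha> s)))"
    (is "?V = (INF \<alpha>\<in>?U. ?W \<alpha> + ?R \<alpha>)")
proof (rule antisym)
  have V_le: "?V \<le> ?W \<alpha> + ?R \<alpha>" if \<alpha>: "\<alpha> \<in> ?U" for \<alpha>
  proof -
    have "?V - ?R \<alpha> \<le> ?W \<alpha>"
    proof (rule cINF_greatest[OF nonempty])
      fix \<beta> assume \<beta>: "\<beta> \<in> ?U"
      have "?V \<le> l \<bullet> cost_functional F h g T x t (\<lambda>s. if s < \<tau> then \<alpha> s else \<beta> s)"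
        using t by (intro cINF_lower scalarized_cost_bdd_below concat_control_admissible \<alpha> \<beta>) auto
      then show "?V - ?R \<alpha> \<le> l \<bullet> cost_functional F h g T (trajectory F T x t \<alpha> \<tau>) \<tau> \<beta>"
        unfolding cost_functional_concat[OF \<alpha> \<beta> t] by (simp add: inner_add_right)
    qed
    then show ?thesis
      by simp
  qed
  then show "?V \<le> (INF \<alpha>\<in>?U. ?W \<alpha> + ?R \<alpha>)"
    by (intro cINF_greatest nonempty)
  show "(INF \<alpha>\<in>?U. ?W \<alpha> + ?R \<alpha>) \<le> ?V"
  proof (rule cINF_greatest[OF nonempty])
    fix \<alpha> assume \<alpha>: "\<alpha> \<in> ?U"
    \<comment> \<open>the inequality already proved provides the lower bound that the infimum needs\<close>
    have "(INF \<alpha>\<in>?U. ?W \<alpha> + ?R \<alpha>) \<le> ?W \<alpha> + ?R \<alpha>"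
      using V_le by (intro cINF_lower \<alpha> bdd_belowI2)
    also have "?W \<alpha> \<le> l \<bullet> cost_functional F h g T (trajectory F T x t \<alpha> \<tau>) \<tau> \<alpha>"
      using t by (intro cINF_lower scalarized_cost_bdd_below \<alpha>) auto
    finally show "(INF \<alpha>\<in>?U. ?W \<alpha> + ?R \<alpha>) \<le> l \<bullet> cost_functional F h g T x t \<alpha>"
      using cost_functional_split[OF \<alpha> t] by (simp add: inner_add_right)
  qed
qed

end

section \<open>Vectorial value functions\<close>

theorem proposition3p5:
  fixes T C :: real
    and A :: "(real ^ 'm) set"
    and F :: "real ^ 'n \<Rightarrow> real ^ 'm \<Rightarrow> real ^ 'n"
    and h :: "real ^ 'n \<Rightarrow> real ^ 'm \<Rightarrow> real ^ 'N"
    and g :: "real ^ 'n \<Rightarrow> real ^ 'N"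
    and K :: "(real ^ 'N) set"
    and lam :: "real ^ 'N"
    and u :: "real ^ 'n \<Rightarrow> real \<Rightarrow> real ^ 'N"
    and x :: "real ^ 'n"
    and t \<delta> :: real
  assumes "T > 0"
    and "compact A"
    and "continuous_on (UNIV \<times> A) (\<lambda>(y, a). F y a)"
    and "\<And>y a. a \<in> A \<Longrightarrow> norm (F y a) \<le> C"
    and "\<And>y. norm (g y) \<le> C"
    and "\<And>y a. a \<in> A \<Longrightarrow> norm (h y a) \<le> C"
    and "\<And>y z a. a \<in> A \<Longrightarrow> norm (F y a - F z a) \<le> C * norm (y - z)"
    and "\<And>y z. norm (g y - g z) \<le> C * norm (y - z)"
    and "\<And>y z a. a \<in> A \<Longrightarrow> norm (h y a - h z a) \<le> C * norm (y - z)"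
    \<comment> \<open>the integral in the cost functional makes sense for every admissible control\<close>
    and "\<And>y s \<alpha>. \<lbrakk>s \<in> {0<..<T}; \<alpha> \<in> admissible_controls T A\<rbrakk> \<Longrightarrow>
           set_integrable lebesgue {s..T} (\<lambda>r. h (trajectory F T y s \<alpha> r) (\<alpha> r))"
    and "proper_cone K"
    and "lam \<in> dual_cone K"
    and "vectorial_value_function F h g T A K lam u"
    and "t \<in> {0<..<T}"
    and "\<delta> > 0"
    and "t + \<delta> \<le> T"
  shows "lam \<bullet> u x t =
    (INF \<alpha>\<in>admissible_controls T A.
       scalarized_value g T lam u (trajectory F T x t \<alpha> (t + \<delta>)) (t + \<delta>) +
       (LINT s:{t..t + \<delta>}|lebesgue. lam \<bullet> h (trajectory F T x t \<alpha> s) (\<alpha> s)))"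
proof -
  interpret lipschitz_control_problem T C A F h g
    by unfold_locales (fact compact_imp_closed[OF \<open>compact A\<close>] assms)+
  have u_inf: "lam \<bullet> u y s = (INF \<alpha>\<in>admissible_controls T A. lam \<bullet> cost_functional F h g T y s \<alpha>)"
    if "s \<in> {0<..<T}" for y s
    using \<open>vectorial_value_function F h g T A K lam u\<close> that
    by (simp add: vectorial_value_function_def)
  have "u x t \<in> cost_set F h g T A x t"
    using \<open>vectorial_value_function F h g T A K lam u\<close> \<open>t \<in> {0<..<T}\<close>
    by (simp add: vectorial_value_function_def pareto_minimal_def)
  then have nonempty: "admissible_controls T A \<noteq> {}"
    by (auto simp: cost_set_def)
  have inner: "(LINT s:{t..t + \<delta>}|lebesgue. lam \<bullet> h (trajectory F T x t \<alpha> s) (\<alpha> s)) =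
      lam \<bullet> (LINT s:{t..t + \<delta>}|lebesgue. h (trajectory F T x t \<alpha> s) (\<alpha> s))"
    if "\<alpha> \<in> admissible_controls T A" for \<alpha>
    using that assms(14,16)
    by (intro set_integral_inner_right set_integrable_subinterval[OF running_cost_integrable]) auto
  show ?thesis
  proof (cases "t + \<delta> = T")
    case True
    show ?thesis
      unfolding u_inf[OF \<open>t \<in> {0<..<T}\<close>]
    proof (rule INF_cong[OF refl])
      fix \<alpha> assume "\<alpha> \<in> admissible_controls T A"
      from inner[OF this] show "lam \<bullet> cost_functional F h g T x t \<alpha> =
          scalarized_value g T lam u (trajectory F T x t \<alpha> (t + \<delta>)) (t + \<delta>) +
          (LINT s:{t..t + \<delta>}|lebesgue. lam \<bullet> h (trajectory F T x t \<alpha> s) (\<alpha> s))"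
        by (simp add: True scalarized_value_def cost_functional_def inner_add_right)
    qed
  next
    case False
    then have \<tau>: "0 < t" "t \<le> t + \<delta>" "t + \<delta> < T" "t + \<delta> \<in> {0<..<T}"
      using assms(14-16) by auto
    show ?thesis
      unfolding u_inf[OF \<open>t \<in> {0<..<T}\<close>] dynamic_programming_principle[OF nonempty \<tau>(1-3)]
      by (rule INF_cong[OF refl])
         (simp add: inner scalarized_value_def u_inf[OF \<tau>(4)] False)
  qed
qed

end
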